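(* Let $\rho$ be a metric on $V$, and assume that there exists a constant $M>0$ such that $$\sup_{x\in V}\frac12\sum_{y\sim x}\rho^2(x,y)q(x,y)\le M.$$ Let $K:=\inf_w K(w)$, the infimum being over all length functions $w$ on $E$, where $$K(w)=\max_{\mathbf{e}\in E}\frac{1}{Q(\mathbf{e})w(\mathbf{e})}\sum_{x,y\in V}\mathbb{E}^\gamma\,1_{\gamma_{xy}}(\mathbf{e})\,\rho^2(x,y)\,|\gamma_{xy}|_w\,\mu(x)\mu(y).$$ Then the transportation-entropy inequality $$W_{1,\rho}^2(\nu,\mu)\le\sqrt{2KM}\,H(\nu|\mu)\qquad\text{for all probability measures }\nu\text{ on }V$$ holds, or equivalently, for every Lipschitzian function $g:V\to\mathbb{R}$, $$\int e^{\lambda(g-\mu(g))}\,d\mu\le\exp\Big(\frac{\lambda^2\sqrt{2MK}}{4}\|g\|_{{\rm Lip}(\rho)}^2\Big),\qquad\lambda\in\mathbb{R}.$$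
   Context: Setting: $G=(V,E)$ is a finite connected graph with vertex set $V$ and set of oriented edges $E\subset V^2\setminus\{(x,x):x\in V\}$, which is symmetric; $x\sim y$ means $(x,y)\in E$. Jump rates $q(x,y)\ge 0$ are given with $q(x,y)>0$ if and only if $x\sim y$. A probability measure $\mu$ on $V$ satisfies the detailed balance condition $Q(x,y):=\mu(x)q(x,y)=\mu(y)q(y,x)$ for all $(x,y)\in E$. For $\mathbf{e}=(x,y)\in E$ write $Q(\mathbf{e})=Q(x,y)$. Write $\mu(g)=\sum_x g(x)\mu(x)$. $W_{1,\rho}(\nu,\mu)=\inf_\pi\sum_{x,y}\rho(x,y)\pi(x,y)$ over couplings $\pi$ of $(\nu,\mu)$. $H(\nu|\mu)=\sum_{x\in V}\nu(x)\log\frac{\nu(x)}{\mu(x)}$ if $\nu\ll\mu$ and $+\infty$ otherwise. $\|g\|_{{\rm Lip}(\rho)}$ is the Lipschitz norm (best Lipschitz constant) of $g$ with respect to $\rho$. A path $\gamma_{xy}$ from $x$ to $y$ is a family of edges $\{\mathbf{e}_1,\dots,\mathbf{e}_n\}$ with $\mathbf{e}_k=(x_{k-1},x_k)\in E$, $x_0=x$, $x_n=y$; it has no circle if all $x_0,\dots,x_n$ are different. A length function is a function $w:E\to(0,\infty)$ with $w(x,y)=w(y,x)$; $|\gamma_{xy}|_w=\sum_{\mathbf{e}\in\gamma_{xy}}w(\mathbf{e})$. For every $x\ne y$ in $V$, $\gamma_{xy}$ is a given random (possibly deterministic) path without circle from $x$ to $y$; $\gamma_{xx}=\emptyset$. $\mathbb{E}^\gamma$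 is the expectation with respect to the random family $\{\gamma_{xy}:x,y\in V\}$, and $1_{\gamma_{xy}}(\mathbf{e})=1$ if $\mathbf{e}\in\gamma_{xy}$ and $0$ otherwise. *)

theory Defs
  imports
    "HOL-Probability.Probability"
    "Graph_Theory.Pair_Digraph"
    "Graph_Theory.Digraph_Component"
begin

definition Qflow :: "'v pmf \<Rightarrow> ('v \<Rightarrow> 'v \<Rightarrow> real) \<Rightarrow> 'v \<times> 'v \<Rightarrow> real" where
  "Qflow \<mu> q e = pmf \<mu> (fst e) * q (fst e) (snd e)"

definition detailed_balance :: "('v \<times> 'v) set \<Rightarrow> 'v pmf \<Rightarrow> ('v \<Rightarrow> 'v \<Rightarrow> real) \<Rightarrow> bool" where
  "detailed_balance E \<mu> q \<longleftrightarrow>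
     (\<forall>(x, y) \<in> E. pmf \<mu> x * q x y = pmf \<mu> y * q y x)"

definition couplings :: "'v pmf \<Rightarrow> 'v pmf \<Rightarrow> ('v \<times> 'v) pmf set" where
  "couplings \<nu> \<mu> = {\<pi>. map_pmf fst \<pi> = \<nu> \<and> map_pmf snd \<pi> = \<mu>}"

definition W1 :: "'v set \<Rightarrow> ('v \<Rightarrow> 'v \<Rightarrow> real) \<Rightarrow> 'v pmf \<Rightarrow> 'v pmf \<Rightarrow> real" where
  "W1 V \<rho> \<nu> \<mu> = (INF \<pi>\<in>couplings \<nu> \<mu>. \<Sum>x\<in>V. \<Sum>y\<in>V. \<rho> x y * pmf \<pi> (x, y))"

text \<open>The convention \<open>0 * log 0 = 0\<close> is automatic, as \<open>ln\<close> is total.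
  Note the argument order: \<^term>\<open>absolutely_continuous M N\<close> says that \<open>N\<close> is absolutely
  continuous with respect to \<open>M\<close>.\<close>

definition rel_entropy :: "'v set \<Rightarrow> 'v pmf \<Rightarrow> 'v pmf \<Rightarrow> ereal" where
  "rel_entropy V \<nu> \<mu> =
     (if absolutely_continuous (measure_pmf \<mu>) (measure_pmf \<nu>)
      then ereal (\<Sum>x\<in>V. pmf \<nu> x * ln (pmf \<nu> x / pmf \<mu> x))
      else \<infinity>)"

definition Lip_norm :: "'v set \<Rightarrow> ('v \<Rightarrow> 'v \<Rightarrow> real) \<Rightarrow> ('v \<Rightarrow> real) \<Rightarrow> real" where
  "Lip_norm V \<rho> g = Inf {L. 0 \<le> L \<and> (\<forall>x\<in>V. \<forall>y\<in>V. \<bar>g x - g y\<bar> \<le> L * \<rho> x y)}"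

text \<open>Only the values on \<open>E\<close> of a length function are constrained or ever used.\<close>

definition length_function :: "('v \<times> 'v) set \<Rightarrow> ('v \<times> 'v \<Rightarrow> real) \<Rightarrow> bool" where
  "length_function E w \<longleftrightarrow> (\<forall>(x, y) \<in> E. 0 < w (x, y) \<and> w (x, y) = w (y, x))"

definition path_length :: "('v \<times> 'v \<Rightarrow> real) \<Rightarrow> ('v \<times> 'v) list \<Rightarrow> real" where
  "path_length w p = (\<Sum>e\<in>set p. w e)"

text \<open>A path is the list of its edges, and
  \<^const>\<open>pre_digraph.apath\<close> demands in addition that its vertices be distinct (no circle);
  in particular the only such path from a vertex to itself is empty.
  The random family is modelled on a probability space \<open>P\<close>: \<open>\<gamma> \<omega> x y\<close> is the realisation
  at \<open>\<omega>\<close> of the path from \<open>x\<close> to \<open>y\<close>. There are only finitely many paths without circle in a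
  finite graph, so the discrete sigma-algebra is the appropriate one.\<close>

definition random_paths ::
  "'v pair_pre_digraph \<Rightarrow> 'w measure \<Rightarrow> ('w \<Rightarrow> 'v \<Rightarrow> 'v \<Rightarrow> ('v \<times> 'v) list) \<Rightarrow> bool" where
  "random_paths G P \<gamma> \<longleftrightarrow> prob_space P \<and>
     (\<forall>x\<in>pverts G. \<forall>y\<in>pverts G.
        (\<lambda>\<omega>. \<gamma> \<omega> x y) \<in> measurable P (count_space UNIV) \<and>
        (\<forall>\<omega>\<in>space P. pre_digraph.apath (with_proj G) x (\<gamma> \<omega> x y) y))"

text \<open>The edge set is empty exactly if the connected graph has a single vertex; the maximum of
  the empty family of nonnegative quantities is then read as 0.\<close>

definition Kw :: "'v pair_pre_digraph \<Rightarrow> 'v pmf \<Rightarrow> ('v \<Rightarrow> 'v \<Rightarrow> real) \<Rightarrow> ('v \<Rightarrow> 'v \<Rightarrow> real) \<Rightarrow>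
    'w measure \<Rightarrow> ('w \<Rightarrow> 'v \<Rightarrow> 'v \<Rightarrow> ('v \<times> 'v) list) \<Rightarrow> ('v \<times> 'v \<Rightarrow> real) \<Rightarrow> real" where
  "Kw G \<mu> q \<rho> P \<gamma> w =
     (if parcs G = {} then 0
      else Max ((\<lambda>e. 1 / (Qflow \<mu> q e * w e) *
             (\<Sum>x\<in>pverts G. \<Sum>y\<in>pverts G.
                (\<integral>\<omega>. indicator (set (\<gamma> \<omega> x y)) e * (\<rho> x y)\<^sup>2 * path_length w (\<gamma> \<omega> x y) \<partial>P)
                * pmf \<mu> x * pmf \<mu> y)) ` parcs G))"

definition Kconst :: "'v pair_pre_digraph \<Rightarrow> 'v pmf \<Rightarrow> ('v \<Rightarrow> 'v \<Rightarrow> real) \<Rightarrow> ('v \<Rightarrow> 'v \<Rightarrow> real) \<Rightarrow>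
    'w measure \<Rightarrow> ('w \<Rightarrow> 'v \<Rightarrow> 'v \<Rightarrow> ('v \<times> 'v) list) \<Rightarrow> real" where
  "Kconst G \<mu> q \<rho> P \<gamma> = (INF w\<in>{w. length_function (parcs G) w}. Kw G \<mu> q \<rho> P \<gamma> w)"

end

theory Submission
  imports Defs
begin

text \<open>
  Both inequalities come from one bound on exponential moments. Let \<open>g\<close> have Lipschitz constant
  \<open>L\<close>, put \<open>Z(l) = \<mu>(exp (l g))\<close> and \<open>s\<^sup>2 = exp (l g) / Z(l)\<close>. Then \<open>(ln Z)'(l) = \<mu>(s\<^sup>2 g)\<close> is the mean
  of \<open>g\<close> under a tilted measure, and it suffices to show that the tilting moves the mean by at most
  \<open>l L\<^sup>2 sqrt (2 M K) / 2\<close>; integrating in \<open>l\<close> gives the Gaussian bound (\<open>exp_moment_le\<close>).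

  The shift of the mean is controlled in three steps. Symmetrising,
  \<open>2 (\<mu>(s\<^sup>2 g) - \<mu>(g))\<close> is the integral of \<open>(g x - g y) (s x - s y) (s x + s y)\<close> against \<open>\<mu> \<otimes> \<mu>\<close>, and
  as \<open>\<mu>(s\<^sup>2) = 1\<close> the Cauchy-Schwarz inequality bounds its square by
  \<open>4 L\<^sup>2\<close> times the integral of \<open>\<rho>(x, y)\<^sup>2 (s x - s y)\<^sup>2\<close> (\<open>tilted_mean_deviation\<close>). Writing \<open>s x - s y\<close> as
  a sum of increments along the random path from \<open>x\<close> to \<open>y\<close> bounds that integral by
  \<open>K\<close> times the sum of \<open>Q(x, y) (s x - s y)\<^sup>2\<close> over oriented edges (\<open>weighted_Poincare\<close>). Finally \<open>s\<close> is
  the exponential of a Lipschitz function, so this energy is at most \<open>l\<^sup>2 L\<^sup>2 M / 2\<close>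
  (\<open>Dirichlet_energy_exp_le\<close>).

  The transport-entropy inequality follows by the Bobkov-Goetze argument. Kantorovich
  duality supplies a 1-Lipschitz \<open>g\<close> with \<open>W\<^sub>1 \<le> \<nu>(g) - \<mu>(g)\<close> (\<open>Kantorovich_dual_potential\<close>), the
  Gibbs variational inequality and the moment bound give \<open>l W\<^sub>1 \<le> H(\<nu>|\<mu>) + l\<^sup>2 sqrt (2 K M) / 4\<close> for all
  \<open>l\<close>, and one optimises over \<open>l\<close>.
\<close>

section \<open>Kantorovich duality on a finite set\<close>

definition transport_plans :: "'v set \<Rightarrow> ('v \<Rightarrow> real) \<Rightarrow> ('v \<Rightarrow> real) \<Rightarrow> ('v \<times> 'v \<Rightarrow> real) set" where
  "transport_plans V n m = {a. (\<forall>p. 0 \<le> a p) \<and> (\<forall>p. p \<notin> V \<times> V \<longrightarrow> a p = 0) \<and>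
     (\<forall>x\<in>V. (\<Sum>y\<in>V. a (x, y)) = n x) \<and> (\<forall>y\<in>V. (\<Sum>x\<in>V. a (x, y)) = m y)}"

text \<open>Plans are functions that vanish outside \<open>V \<times> V\<close>, so they lie in a product of compact
  intervals, compact by Tychonoff's theorem; the marginal conditions involve finitely many
  coordinates each and are therefore closed in the product topology.\<close>

lemma compact_transport_plans:
  assumes "finite V"
  shows "compact (transport_plans V n m)"
proof -
  define box where "box = PiE UNIV (\<lambda>p. if p \<in> V \<times> V then {0 .. n (fst p)} else {0})"
  have "compactin (product_topology (\<lambda>_. euclidean) UNIV) box"
    unfolding box_def compactin_PiE by (auto simp: compactin_euclidean_iff)
  then have "compact box"
    by (simp add: euclidean_product_topology compactin_euclidean_iff)
  moreover have "closed {a. (\<forall>x\<in>V. (\<Sum>y\<in>V. a (x, y)) = n x) \<and> (\<forall>y\<in>V. (\<Sum>x\<in>V. a (x, y)) = m y)}"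
    unfolding Ball_def imp_conv_disj
    by (intro closed_Collect_conj closed_Collect_all closed_Collect_disj closed_Collect_const
        closed_Collect_eq continuous_on_sum continuous_on_product_coordinates continuous_on_const)
  ultimately have "compact (box \<inter> {a. (\<forall>x\<in>V. (\<Sum>y\<in>V. a (x, y)) = n x) \<and> (\<forall>y\<in>V. (\<Sum>x\<in>V. a (x, y)) = m y)})"
    by (rule compact_Int_closed)
  also have "box \<inter> {a. (\<forall>x\<in>V. (\<Sum>y\<in>V. a (x, y)) = n x) \<and> (\<forall>y\<in>V. (\<Sum>x\<in>V. a (x, y)) = m y)}
      = transport_plans V n m"
  proof -
    have "a (x, y) \<le> n x" if "a \<in> transport_plans V n m" "x \<in> V" "y \<in> V" for a x y
      using member_le_sum[of y V "\<lambda>y. a (x, y)"] that assms by (auto simp: transport_plans_def)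
    then have "a \<in> box" if "a \<in> transport_plans V n m" for a
      using that by (auto simp: box_def PiE_iff transport_plans_def)
    moreover have "0 \<le> a p \<and> (p \<notin> V \<times> V \<longrightarrow> a p = 0)" if "a \<in> box" for a p
      using PiE_mem[OF that[unfolded box_def] UNIV_I, of p]
      by (cases "p \<in> V \<times> V") (simp_all only: if_True if_False atLeastAtMost_iff singleton_iff, simp_all)
    ultimately show ?thesis
      unfolding transport_plans_def Int_def mem_Collect_eq by blast
  qed
  finally show ?thesis .
qed

lemma optimal_plan_exists:
  assumes "finite V" "transport_plans V n m \<noteq> {}"
  obtains a where "a \<in> transport_plans V n m"
    "\<And>b. b \<in> transport_plans V n m \<Longrightarrow>
       (\<Sum>p\<in>V \<times> V. \<rho> p * a p) \<le> (\<Sum>p\<in>V \<times> V. \<rho> p * b p :: real)"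
proof -
  have "continuous_on (transport_plans V n m) (\<lambda>a. \<Sum>p\<in>V \<times> V. \<rho> p * a p)"
    by (intro continuous_intros continuous_on_subset[OF continuous_on_product_coordinates]) auto
  from continuous_attains_inf[OF compact_transport_plans[OF assms(1)] assms(2) this]
  show ?thesis using that by blast
qed

lemma transport_plan_to_coupling:
  fixes \<nu> \<mu> :: "'v pmf"
  assumes V: "finite V" "set_pmf \<nu> \<subseteq> V" "set_pmf \<mu> \<subseteq> V"
    and a: "a \<in> transport_plans V (pmf \<nu>) (pmf \<mu>)"
  obtains \<pi> where "\<pi> \<in> couplings \<nu> \<mu>" "pmf \<pi> = a"
proof -
  note a' = a[unfolded transport_plans_def, simplified]
  have supp: "{p. a p \<noteq> 0} \<subseteq> V \<times> V" using a' by auto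
  have "(\<Sum>p\<in>V \<times> V. a p) = (\<Sum>x\<in>V. \<Sum>y\<in>V. a (x, y))"
    by (simp add: sum.cartesian_product)
  also have "\<dots> = 1" using a' V sum_pmf_eq_1[of V \<nu>] by simp
  finally have tot: "(\<Sum>p\<in>V \<times> V. a p) = 1" .
  have "(\<integral>\<^sup>+p. ennreal (a p) \<partial>count_space UNIV) = (\<Sum>p\<in>V \<times> V. ennreal (a p))"
    using V supp a' by (intro nn_integral_count_space') auto
  also have "\<dots> = 1" using a' tot by (subst sum_ennreal) auto
  finally have pmf: "pmf (embed_pmf a) = a"
    using a' pmf_embed_pmf[of a] by (metis ext surj_pair)
  define \<pi> where "\<pi> = embed_pmf a"
  have fin: "finite (set_pmf \<pi>)" and sub: "set_pmf \<pi> \<subseteq> V \<times> V"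
    using supp V pmf finite_subset[OF supp] by (auto simp: \<pi>_def set_pmf_eq)
  have m: "measure \<pi> S = (\<Sum>p\<in>(V \<times> V) \<inter> S. a p)" for S
  proof -
    have "measure \<pi> S = measure \<pi> ((V \<times> V) \<inter> S)"
      by (rule measure_prob_cong_0) (use sub in \<open>auto simp: set_pmf_eq\<close>)
    then show ?thesis using V by (simp add: measure_measure_pmf_finite pmf \<pi>_def)
  qed
  have "map_pmf fst \<pi> = \<nu>"
  proof (rule pmf_eqI)
    fix x
    have "pmf (map_pmf fst \<pi>) x = (\<Sum>p\<in>(V \<times> V) \<inter> fst -` {x}. a p)" by (simp add: pmf_map m)
    also have "\<dots> = pmf \<nu> x"
    proof (cases "x \<in> V")
      case True
      then have "(V \<times> V) \<inter> fst -` {x} = Pair x ` V" by auto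
      then show ?thesis using True a' by (simp add: sum.reindex inj_on_def)
    next
      case False
      then have "(V \<times> V) \<inter> fst -` {x} = {}" by auto
      then show ?thesis using False V by (auto simp: set_pmf_eq)
    qed
    finally show "pmf (map_pmf fst \<pi>) x = pmf \<nu> x" .
  qed
  moreover have "map_pmf snd \<pi> = \<mu>"
  proof (rule pmf_eqI)
    fix y
    have "pmf (map_pmf snd \<pi>) y = (\<Sum>p\<in>(V \<times> V) \<inter> snd -` {y}. a p)" by (simp add: pmf_map m)
    also have "\<dots> = pmf \<mu> y"
    proof (cases "y \<in> V")
      case True
      then have "(V \<times> V) \<inter> snd -` {y} = (\<lambda>x. (x, y)) ` V" by auto
      then show ?thesis using True a' by (simp add: sum.reindex inj_on_def)
    next
      case False
      then have "(V \<times> V) \<inter> snd -` {y} = {}" by auto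
      then show ?thesis using False V by (auto simp: set_pmf_eq)
    qed
    finally show "pmf (map_pmf snd \<pi>) y = pmf \<mu> y" .
  qed
  ultimately show ?thesis using that[of \<pi>] pmf by (simp add: couplings_def \<pi>_def)
qed

text \<open>The directions in which a plan \<open>a\<close> can be changed when the source marginal is kept and one unit
  of target mass is moved from \<open>y0\<close> to \<open>y\<close>: mass may be removed only where \<open>a\<close> has some. The infimum
  of the cost over these directions is the one-sided derivative of the optimal cost, that is, a dual
  potential at \<open>y\<close> normalised to vanish at \<open>y0\<close>. Working with arbitrary signed variations spares
  the chains of edges in the usual construction from cyclical monotonicity.\<close>

definition plan_variations :: "'v set \<Rightarrow> ('v \<times> 'v \<Rightarrow> real) \<Rightarrow> 'v \<Rightarrow> 'v \<Rightarrow> ('v \<times> 'v \<Rightarrow> real) set" where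
  "plan_variations V a y0 y = {\<theta>. (\<forall>p. p \<notin> V \<times> V \<longrightarrow> \<theta> p = 0) \<and>
     (\<forall>p. \<theta> p < 0 \<longrightarrow> 0 < a p) \<and> (\<forall>x\<in>V. (\<Sum>z\<in>V. \<theta> (x, z)) = 0) \<and>
     (\<forall>z\<in>V. (\<Sum>x\<in>V. \<theta> (x, z)) = of_bool (z = y) - of_bool (z = y0))}"

text \<open>A variation that moves no target mass can be added to the plan in a small positive multiple, and
  the result still has the same marginals; optimality then forbids a negative cost.\<close>

lemma closed_variation_cost_nonneg:
  assumes V: "finite V" and a: "a \<in> transport_plans V n m"
    and opt: "\<And>b. b \<in> transport_plans V n m \<Longrightarrow>
       (\<Sum>p\<in>V \<times> V. \<rho> p * a p) \<le> (\<Sum>p\<in>V \<times> V. \<rho> p * b p :: real)"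
    and th: "\<theta> \<in> plan_variations V a y y"
  shows "0 \<le> (\<Sum>p\<in>V \<times> V. \<rho> p * \<theta> p)"
proof -
  note a' = a[unfolded transport_plans_def, simplified]
  note th' = th[unfolded plan_variations_def, simplified]
  have "\<exists>e>0. \<forall>p\<in>V \<times> V. 0 \<le> a p + e * \<theta> p"
  proof -
    have "\<forall>\<^sub>F e in at_right 0. 0 \<le> a p + e * \<theta> p" for p
    proof (cases "\<theta> p < 0")
      case True
      then have "0 < a p" using th' by (cases p) auto
      moreover have "((\<lambda>e. a p + e * \<theta> p) \<longlongrightarrow> a p + 0 * \<theta> p) (at_right 0)"
        by (intro tendsto_intros)
      ultimately have "\<forall>\<^sub>F e in at_right 0. 0 < a p + e * \<theta> p"
        by (intro order_tendstoD(1)[where y = "a p + 0 * \<theta> p"]) auto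
      then show ?thesis by eventually_elim simp
    next
      case False
      have "0 \<le> a p" using a' by (cases p) auto
      with False have "0 \<le> a p + e * \<theta> p" if "0 < e" for e using that by simp
      then show ?thesis by (auto simp: eventually_at_right_field intro: exI[of _ 1])
    qed
    then have "\<forall>\<^sub>F e in at_right 0. \<forall>p\<in>V \<times> V. 0 \<le> a p + e * \<theta> p"
      using V by (intro eventually_ball_finite) auto
    moreover have "\<forall>\<^sub>F e in at_right 0. 0 < (e::real)"
      by (simp add: eventually_at_right_less)
    ultimately have "\<forall>\<^sub>F e in at_right 0. 0 < e \<and> (\<forall>p\<in>V \<times> V. 0 \<le> a p + e * \<theta> p)"
      by (rule eventually_conj[rotated])
    from eventually_happens'[OF _ this] show ?thesis by auto
  qed
  then obtain e where e: "e > 0" "\<And>p. p \<in> V \<times> V \<Longrightarrow> 0 \<le> a p + e * \<theta> p" by blast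
  define b where "b p = a p + e * \<theta> p" for p
  have "b \<in> transport_plans V n m"
  proof -
    have "0 \<le> b p" for p
      using e(2)[of p] a' th' by (cases p; cases "p \<in> V \<times> V") (auto simp: b_def)
    then show ?thesis
      using a' th' by (simp add: transport_plans_def b_def sum.distrib flip: sum_distrib_left)
  qed
  from opt[OF this] have "0 \<le> e * (\<Sum>p\<in>V \<times> V. \<rho> p * \<theta> p)"
    by (simp add: b_def sum.distrib algebra_simps sum_distrib_left)
  with e(1) show ?thesis by (simp add: zero_le_mult_iff)
qed

text \<open>Rerouting one unit of the mass that \<open>a\<close> sends from \<open>x\<close> to \<open>y\<close> so that it arrives at \<open>z\<close> turns a
  variation ending in \<open>y\<close> into one ending in \<open>z\<close>. This single operation yields every property of the
  dual potential.\<close>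

lemma plan_variations_shift:
  assumes V: "finite V" and th: "\<theta> \<in> plan_variations V a y0 y"
    and xyz: "x \<in> V" "y \<in> V" "z \<in> V" and pos: "0 < a (x, y)"
  defines "\<theta>' \<equiv> \<lambda>p. \<theta> p + of_bool (p = (x, z)) - of_bool (p = (x, y))"
  shows "\<theta>' \<in> plan_variations V a y0 z"
    and "(\<Sum>p\<in>V \<times> V. \<rho> p * \<theta>' p) = (\<Sum>p\<in>V \<times> V. \<rho> p * \<theta> p) + \<rho> (x, z) - (\<rho> (x, y) :: real)"
proof -
  note th' = th[unfolded plan_variations_def, simplified]
  have s: "(\<Sum>v\<in>V. of_bool (v = c \<and> P) :: real) = of_bool P" if "c \<in> V" for c P
    using V that by (cases P) (auto simp: of_bool_def)
  have "0 < a p" if "\<theta>' p < 0" for p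
    using that th' pos by (cases p) (auto simp: \<theta>'_def of_bool_def split: if_splits)
  then show "\<theta>' \<in> plan_variations V a y0 z"
    using th' xyz s[of y] s[of z] s[of x]
    by (auto simp: plan_variations_def \<theta>'_def sum.distrib sum_subtractf conj_commute)
  have "(\<Sum>p\<in>V \<times> V. \<rho> p * of_bool (p = (x, v))) = \<rho> (x, v)" if "v \<in> V" for v
    using V xyz(1) that by (simp add: of_bool_def if_distrib cong: if_cong)
  then show "(\<Sum>p\<in>V \<times> V. \<rho> p * \<theta>' p) = (\<Sum>p\<in>V \<times> V. \<rho> p * \<theta> p) + \<rho> (x, z) - \<rho> (x, y)"
    using xyz by (simp add: \<theta>'_def algebra_simps sum.distrib sum_subtractf)
qed

text \<open>Complementary slackness. With \<open>\<phi> y\<close> the least cost of a variation ending in \<open>y\<close>, rerouting gives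
  \<open>\<phi> z \<le> \<phi> y + \<rho> x z - \<rho> x y\<close> whenever \<open>a\<close> charges \<open>(x, y)\<close>. Taking \<open>z = x\<close> shows that \<open>- \<phi>\<close> drops from \<open>x\<close> to \<open>y\<close> by at
  least \<open>\<rho> x y\<close> along the charged pair; the triangle inequality turns the same estimate into the
  Lipschitz property, for which every \<open>y\<close> must receive some mass, whence the positivity of \<open>m\<close>.\<close>

lemma optimal_plan_potential:
  assumes V: "finite V" and a: "a \<in> transport_plans V n m"
    and opt: "\<And>b. b \<in> transport_plans V n m \<Longrightarrow>
       (\<Sum>p\<in>V \<times> V. \<rho> (fst p) (snd p) * a p) \<le> (\<Sum>p\<in>V \<times> V. \<rho> (fst p) (snd p) * b p)"
    and m: "\<And>y. y \<in> V \<Longrightarrow> 0 < m y"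
    and \<rho>: "Metric_space V \<rho>"
  obtains g :: "'v \<Rightarrow> real"
  where "\<And>x y. x \<in> V \<Longrightarrow> y \<in> V \<Longrightarrow> g x - g y \<le> \<rho> x y"
    and "\<And>x y. x \<in> V \<Longrightarrow> y \<in> V \<Longrightarrow> 0 < a (x, y) \<Longrightarrow> \<rho> x y \<le> g x - g y"
proof (cases "V = {}")
  case True
  then show ?thesis using that by auto
next
  case False
  then obtain y0 where y0: "y0 \<in> V" by auto
  interpret Metric_space V \<rho> by fact
  note a' = a[unfolded transport_plans_def, simplified]
  define cost where "cost \<theta> = (\<Sum>p\<in>V \<times> V. \<rho> (fst p) (snd p) * \<theta> p)" for \<theta> :: "'v \<times> 'v \<Rightarrow> real"
  define \<phi> where "\<phi> y = Inf (cost ` plan_variations V a y0 y)" for y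
  have source: "\<exists>x\<in>V. 0 < a (x, y)" if "y \<in> V" for y
  proof (rule ccontr)
    assume "\<not> ?thesis"
    then have "(\<Sum>x\<in>V. a (x, y)) \<le> 0" by (intro sum_nonpos) auto
    then show False using a' m[OF that] that by auto
  qed
  have shift: "\<exists>\<theta>'\<in>plan_variations V a y0 z. cost \<theta>' = cost \<theta> + \<rho> x z - \<rho> x y"
    if "\<theta> \<in> plan_variations V a y0 y" "0 < a (x, y)" "x \<in> V" "y \<in> V" "z \<in> V" for \<theta> x y z
    using plan_variations_shift(1)[OF V that(1,3,4,5,2)]
      plan_variations_shift(2)[OF V that(1,3,4,5,2), of "\<lambda>p. \<rho> (fst p) (snd p)"]
    unfolding cost_def by auto
  have "(\<lambda>_. 0) \<in> plan_variations V a y0 y0"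
    by (auto simp: plan_variations_def)
  then have ne: "plan_variations V a y0 z \<noteq> {}" if "z \<in> V" for z
    using shift source[OF y0] that y0 by blast
  \<comment> \<open>Rerouting back to \<open>y0\<close> turns any variation into one that moves no target mass.\<close>
  have bdd: "bdd_below (cost ` plan_variations V a y0 y)" if y: "y \<in> V" for y
  proof -
    obtain x where x: "x \<in> V" "0 < a (x, y)" using source[OF y] by blast
    have "\<rho> x y - \<rho> x y0 \<le> cost \<theta>" if th: "\<theta> \<in> plan_variations V a y0 y" for \<theta>
    proof -
      obtain \<theta>' where "\<theta>' \<in> plan_variations V a y0 y0" "cost \<theta>' = cost \<theta> + \<rho> x y0 - \<rho> x y"
        using shift[OF th x(2,1) y y0] by blast
      moreover have "0 \<le> cost \<theta>'"
        using closed_variation_cost_nonneg[OF V a opt] calculation(1) unfolding cost_def by blast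
      ultimately show ?thesis by simp
    qed
    then show ?thesis by (intro bdd_belowI2)
  qed
  have key: "\<phi> z \<le> \<phi> y + \<rho> x z - \<rho> x y" if "x \<in> V" "y \<in> V" "z \<in> V" "0 < a (x, y)" for x y z
  proof -
    have "\<phi> z - \<rho> x z + \<rho> x y \<le> cost \<theta>" if th: "\<theta> \<in> plan_variations V a y0 y" for \<theta>
    proof -
      obtain \<theta>' where "\<theta>' \<in> plan_variations V a y0 z" "cost \<theta>' = cost \<theta> + \<rho> x z - \<rho> x y"
        using shift[OF th \<open>0 < a (x, y)\<close> \<open>x \<in> V\<close> \<open>y \<in> V\<close> \<open>z \<in> V\<close>] by blast
      moreover from this(1) have "\<phi> z \<le> cost \<theta>'"
        unfolding \<phi>_def by (intro cInf_lower bdd \<open>z \<in> V\<close>) auto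
      ultimately show ?thesis by simp
    qed
    then have "\<phi> z - \<rho> x z + \<rho> x y \<le> \<phi> y"
      unfolding \<phi>_def[of y] using ne[OF \<open>y \<in> V\<close>] by (intro cInf_greatest) auto
    then show ?thesis by simp
  qed
  show ?thesis
  proof (rule that[of "\<lambda>x. - \<phi> x"])
    fix z y assume zy: "z \<in> V" "y \<in> V"
    show "- \<phi> z - - \<phi> y \<le> \<rho> z y"
    proof -
      obtain x where x: "x \<in> V" "0 < a (x, z)" using source zy by blast
      show ?thesis using key[OF x(1) zy x(2)] triangle[OF x(1) zy] by simp
    qed
    show "\<rho> z y \<le> - \<phi> z - - \<phi> y" if "0 < a (z, y)"
      using key[OF zy(1) zy(2) zy(1) that] zy by simp
  qed
qed

lemma W1_nonneg:
  assumes "\<And>x y. x \<in> V \<Longrightarrow> y \<in> V \<Longrightarrow> 0 \<le> \<rho> x y"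
  shows "0 \<le> W1 V \<rho> \<nu> \<mu>"
proof -
  have "pair_pmf \<nu> \<mu> \<in> couplings \<nu> \<mu>"
    by (simp add: couplings_def map_fst_pair_pmf map_snd_pair_pmf)
  then show ?thesis
    unfolding W1_def using assms by (intro cINF_greatest sum_nonneg mult_nonneg_nonneg) auto
qed

text \<open>An optimal plan charges only pairs along which the dual potential gains the full distance, so its
  cost equals the difference of the two means of the potential.\<close>

theorem Kantorovich_dual_potential:
  fixes \<nu> \<mu> :: "'v pmf"
  assumes V: "finite V" "set_pmf \<nu> \<subseteq> V" "set_pmf \<mu> = V"
    and \<rho>: "Metric_space V \<rho>"
  obtains g where "\<And>x y. x \<in> V \<Longrightarrow> y \<in> V \<Longrightarrow> g x - g y \<le> \<rho> x y"
    and "W1 V \<rho> \<nu> \<mu> \<le> (\<Sum>x\<in>V. pmf \<nu> x * g x) - (\<Sum>x\<in>V. pmf \<mu> x * g x)"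
proof -
  interpret Metric_space V \<rho> by fact
  have \<nu>1: "(\<Sum>x\<in>V. pmf \<nu> x) = 1" and \<mu>1: "(\<Sum>x\<in>V. pmf \<mu> x) = 1"
    using V by (auto intro: sum_pmf_eq_1)
  have z: "pmf \<nu> x = 0" "pmf \<mu> x = 0" if "x \<notin> V" for x
    using V that by (auto simp: set_pmf_eq)
  \<comment> \<open>The product plan shows that there are plans at all.\<close>
  have "(\<lambda>p. pmf \<nu> (fst p) * pmf \<mu> (snd p)) \<in> transport_plans V (pmf \<nu>) (pmf \<mu>)"
    using \<nu>1 \<mu>1 z by (auto simp: transport_plans_def simp flip: sum_distrib_left sum_distrib_right)
  then have "transport_plans V (pmf \<nu>) (pmf \<mu>) \<noteq> {}" by blast
  then obtain a where a: "a \<in> transport_plans V (pmf \<nu>) (pmf \<mu>)" and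
    opt: "\<And>b. b \<in> transport_plans V (pmf \<nu>) (pmf \<mu>) \<Longrightarrow>
       (\<Sum>p\<in>V \<times> V. \<rho> (fst p) (snd p) * a p) \<le> (\<Sum>p\<in>V \<times> V. \<rho> (fst p) (snd p) * b p)"
    using optimal_plan_exists[OF V(1), where \<rho> = "\<lambda>p. \<rho> (fst p) (snd p)"] by blast
  note a' = a[unfolded transport_plans_def, simplified]
  have "0 < pmf \<mu> y" if "y \<in> V" for y using that V(3) by (simp add: pmf_positive)
  from optimal_plan_potential[OF V(1) a opt this \<rho>]
  obtain g where g: "\<And>x y. x \<in> V \<Longrightarrow> y \<in> V \<Longrightarrow> g x - g y \<le> \<rho> x y"
    "\<And>x y. x \<in> V \<Longrightarrow> y \<in> V \<Longrightarrow> 0 < a (x, y) \<Longrightarrow> \<rho> x y \<le> g x - g y" by blast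
  obtain \<pi> where \<pi>: "\<pi> \<in> couplings \<nu> \<mu>" "pmf \<pi> = a"
    using transport_plan_to_coupling[OF V(1,2) _ a] V(3) by auto
  have "W1 V \<rho> \<nu> \<mu> \<le> (\<Sum>x\<in>V. \<Sum>y\<in>V. \<rho> x y * a (x, y))"
    unfolding W1_def \<pi>(2)[symmetric]
    by (intro cINF_lower \<pi> bdd_belowI2[where m = 0] sum_nonneg mult_nonneg_nonneg) auto
  also have "\<dots> \<le> (\<Sum>x\<in>V. \<Sum>y\<in>V. (g x - g y) * a (x, y))"
  proof (intro sum_mono)
    fix x y assume "x \<in> V" "y \<in> V"
    then show "\<rho> x y * a (x, y) \<le> (g x - g y) * a (x, y)"
      using g(2)[of x y] a' by (cases "a (x, y) = 0") (auto intro!: mult_right_mono simp: less_le)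
  qed
  also have "\<dots> = (\<Sum>x\<in>V. g x * (\<Sum>y\<in>V. a (x, y))) - (\<Sum>y\<in>V. g y * (\<Sum>x\<in>V. a (x, y)))"
    using sum.swap[of "\<lambda>x y. g y * a (x, y)" V V]
    by (simp add: left_diff_distrib sum_subtractf sum_distrib_left)
  also have "\<dots> = (\<Sum>x\<in>V. pmf \<nu> x * g x) - (\<Sum>x\<in>V. pmf \<mu> x * g x)"
    using a' by (simp add: mult.commute)
  finally show ?thesis using that g(1) by blast
qed

section \<open>A weighted Poincare inequality from random paths\<close>

text \<open>Detailed balance propagates positivity of \<open>\<mu>\<close> along an edge, hence along the path \<open>\<gamma> \<omega> x y\<close> of any
  fixed outcome \<open>\<omega>\<close> from a charged vertex \<open>x\<close> to a given \<open>y\<close>.\<close>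

lemma set_pmf_eq_pverts:
  assumes \<gamma>: "random_paths G P \<gamma>" and \<mu>: "set_pmf \<mu> \<subseteq> pverts G"
    and db: "detailed_balance (parcs G) \<mu> q"
    and q: "\<And>x y. (x, y) \<in> parcs G \<Longrightarrow> 0 < q x y \<and> 0 < q y x"
  shows "set_pmf \<mu> = pverts G"
proof -
  interpret P: prob_space P using \<gamma> by (simp add: random_paths_def)
  have step: "y \<in> set_pmf \<mu>" if "pcas x p y" "set p \<subseteq> parcs G" "x \<in> set_pmf \<mu>" for x y p
    using that
  proof (induction p arbitrary: x)
    case (Cons e p)
    obtain z where e: "e = (x, z)" using Cons.prems(1) by (cases e) auto
    have "pmf \<mu> x * q x z = pmf \<mu> z * q z x" "0 < q x z"
      using Cons.prems(2) db q by (auto simp: e detailed_balance_def)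
    moreover have "0 < pmf \<mu> x" using Cons.prems(3) by (rule pmf_positive)
    ultimately have "z \<in> set_pmf \<mu>" by (auto simp: set_pmf_iff)
    then show ?case using Cons e by auto
  qed simp
  have "y \<in> set_pmf \<mu>" if y: "y \<in> pverts G" for y
  proof -
    obtain x where x: "x \<in> set_pmf \<mu>" using set_pmf_not_empty[of \<mu>] by blast
    obtain \<omega> where "\<omega> \<in> space P" using P.not_empty by blast
    then have "pre_digraph.apath (with_proj G) x (\<gamma> \<omega> x y) y"
      using \<gamma> x y \<mu> by (auto simp: random_paths_def)
    then show ?thesis
      using step[of x "\<gamma> \<omega> x y" y] x
      by (auto simp: pre_digraph.apath_def pre_digraph.awalk_def cas_with_proj_eq)
  qed
  then show ?thesis using \<mu> by auto
qed

lemma pcas_sum_increments: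
  fixes h :: "'v \<Rightarrow> real"
  shows "pcas x p y \<Longrightarrow> (\<Sum>e\<leftarrow>p. h (snd e) - h (fst e)) = h y - h x"
  by (induction p arbitrary: x) auto

text \<open>Telescope along the path and apply the Cauchy-Schwarz inequality with weights \<open>w\<close>. The sum
  ranges over a set, so it matters that a path without circle uses no edge twice.\<close>

lemma path_increment_le:
  fixes h :: "'v \<Rightarrow> real"
  assumes G: "pair_wf_digraph G" and p: "pre_digraph.apath (with_proj G) x p y"
    and w: "length_function (parcs G) w"
  shows "(h x - h y)\<^sup>2 \<le> path_length w p * (\<Sum>e\<in>set p. (h (fst e) - h (snd e))\<^sup>2 / w e)"
proof -
  interpret pair_wf_digraph G by fact
  have p': "awalk x p y" "distinct (pawalk_verts x p)" using p by (auto simp: apath_def)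
  then have cas: "pcas x p y" and sub: "set p \<subseteq> parcs G" by (auto simp: awalk_def)
  have dist: "distinct p" using p' distinct_verts_imp_distinct by blast
  have pos: "0 < w e" if "e \<in> set p" for e
    using w sub that by (auto simp: length_function_def)
  have "h y - h x = (\<Sum>e\<in>set p. sqrt (w e) * ((h (snd e) - h (fst e)) / sqrt (w e)))"
    using pos pcas_sum_increments[OF cas, of h] dist
    by (simp add: sum_list_distinct_conv_sum_set less_imp_neq[THEN not_sym])
  then have "(h x - h y)\<^sup>2 = (\<Sum>e\<in>set p. sqrt (w e) * ((h (snd e) - h (fst e)) / sqrt (w e)))\<^sup>2"
    by (simp add: power2_commute[of "h x"])
  also have "\<dots> \<le> (\<Sum>e\<in>set p. (sqrt (w e))\<^sup>2) * (\<Sum>e\<in>set p. ((h (snd e) - h (fst e)) / sqrt (w e))\<^sup>2)"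
    by (rule Cauchy_Schwarz_ineq_sum)
  also have "\<dots> = path_length w p * (\<Sum>e\<in>set p. (h (fst e) - h (snd e))\<^sup>2 / w e)"
    using pos by (simp add: path_length_def power_divide power2_commute less_imp_le)
  finally show ?thesis .
qed

text \<open>Every edge is counted in both orientations and there is no factor one half, so for symmetric \<open>Q\<close>
  this is twice the customary Dirichlet form.\<close>

definition Dirichlet_energy :: "('v \<times> 'v) set \<Rightarrow> ('v \<times> 'v \<Rightarrow> real) \<Rightarrow> ('v \<Rightarrow> real) \<Rightarrow> real" where
  "Dirichlet_energy E Q h = (\<Sum>e\<in>E. Q e * (h (fst e) - h (snd e))\<^sup>2)"

definition weighted_variation ::
  "'v set \<Rightarrow> ('v \<Rightarrow> 'v \<Rightarrow> real) \<Rightarrow> 'v pmf \<Rightarrow> ('v \<Rightarrow> real) \<Rightarrow> real" where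
  "weighted_variation V \<rho> \<mu> h =
     (\<Sum>x\<in>V. \<Sum>y\<in>V. (\<rho> x y)\<^sup>2 * (h x - h y)\<^sup>2 * (pmf \<mu> x * pmf \<mu> y))"

lemma random_paths_nonneg_integral:
  assumes \<gamma>: "random_paths G P \<gamma>" and w: "length_function (parcs G) w"
    and xy: "x \<in> pverts G" "y \<in> pverts G"
  shows "0 \<le> (\<integral>\<omega>. indicator (set (\<gamma> \<omega> x y)) e * (\<rho> x y)\<^sup>2 * path_length w (\<gamma> \<omega> x y) \<partial>P)"
proof (rule Bochner_Integration.integral_nonneg)
  fix \<omega> assume "\<omega> \<in> space P"
  then have "set (\<gamma> \<omega> x y) \<subseteq> parcs G"
    using \<gamma> xy by (auto simp: random_paths_def pre_digraph.apath_def pre_digraph.awalk_def)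
  then have "0 \<le> path_length w (\<gamma> \<omega> x y)"
    using w unfolding path_length_def length_function_def by (intro sum_nonneg) force
  then show "0 \<le> indicator (set (\<gamma> \<omega> x y)) e * (\<rho> x y)\<^sup>2 * path_length w (\<gamma> \<omega> x y)" by simp
qed

text \<open>The canonical path argument: average \<open>path_increment_le\<close> over the random path and over \<open>\<mu> \<otimes> \<mu>\<close>,
  then exchange sums, so that each edge collects exactly the quantity that is maximised in \<open>Kw\<close>.\<close>

lemma canonical_path_estimate:
  fixes h :: "'v \<Rightarrow> real"
  assumes G: "pair_graph G" and \<gamma>: "random_paths G P \<gamma>" and w: "length_function (parcs G) w"
    and Q: "\<And>e. e \<in> parcs G \<Longrightarrow> 0 < Qflow \<mu> q e"
  shows "weighted_variation (pverts G) \<rho> \<mu> h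
           \<le> Kw G \<mu> q \<rho> P \<gamma> w * Dirichlet_energy (parcs G) (Qflow \<mu> q) h"
proof -
  interpret pair_graph G by fact
  interpret P: prob_space P using \<gamma> by (simp add: random_paths_def)
  let ?V = "pverts G" and ?E = "parcs G"
  have fin: "finite ?V" "finite ?E" using pair_finite_verts pair_finite_arcs by auto
  define D where "D e = (h (fst e) - h (snd e))\<^sup>2" for e
  define J where "J e x y \<omega> = indicator (set (\<gamma> \<omega> x y)) e * (\<rho> x y)\<^sup>2 * path_length w (\<gamma> \<omega> x y)" for e x y \<omega>
  define S where "S e = (\<Sum>x\<in>?V. \<Sum>y\<in>?V. (\<integral>\<omega>. J e x y \<omega> \<partial>P) * pmf \<mu> x * pmf \<mu> y)" for e
  have w_pos: "0 < w e" if "e \<in> ?E" for e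
    using w that by (auto simp: length_function_def)
  have path: "apath x (\<gamma> \<omega> x y) y" "set (\<gamma> \<omega> x y) \<subseteq> ?E"
    if "x \<in> ?V" "y \<in> ?V" "\<omega> \<in> space P" for x y \<omega>
    using \<gamma> that by (auto simp: random_paths_def apath_def awalk_def)
  have len: "0 \<le> path_length w (\<gamma> \<omega> x y)" "path_length w (\<gamma> \<omega> x y) \<le> (\<Sum>e\<in>?E. w e)"
    if "x \<in> ?V" "y \<in> ?V" "\<omega> \<in> space P" for x y \<omega>
  proof -
    have "0 \<le> w e" if "e \<in> ?E" for e using w_pos[OF that] by simp
    then show "0 \<le> path_length w (\<gamma> \<omega> x y)" "path_length w (\<gamma> \<omega> x y) \<le> (\<Sum>e\<in>?E. w e)"
      using path(2)[OF that] fin unfolding path_length_def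
      by (auto intro!: sum_nonneg sum_mono2)
  qed
  have int: "integrable P (J e x y)" if "x \<in> ?V" "y \<in> ?V" for e x y
  proof (rule P.integrable_const_bound)
    have "norm (J e x y \<omega>) \<le> (\<rho> x y)\<^sup>2 * (\<Sum>e\<in>?E. w e)" if "\<omega> \<in> space P" for \<omega>
      using len[OF \<open>x \<in> ?V\<close> \<open>y \<in> ?V\<close> that]
      by (auto simp: J_def indicator_def abs_mult intro: mult_left_mono sum_nonneg)
    then show "AE \<omega> in P. norm (J e x y \<omega>) \<le> (\<rho> x y)\<^sup>2 * (\<Sum>e\<in>?E. w e)" by auto
    have "(\<lambda>\<omega>. \<gamma> \<omega> x y) \<in> measurable P (count_space UNIV)"
      using \<gamma> that by (simp add: random_paths_def)
    from measurable_compose[OF this, of "\<lambda>p. indicator (set p) e * (\<rho> x y)\<^sup>2 * path_length w p" borel]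
    show "J e x y \<in> borel_measurable P" by (simp add: J_def[abs_def])
  qed
  have pointwise: "(\<rho> x y)\<^sup>2 * (h x - h y)\<^sup>2 \<le> (\<Sum>e\<in>?E. D e / w e * (\<integral>\<omega>. J e x y \<omega> \<partial>P))"
    if xy: "x \<in> ?V" "y \<in> ?V" for x y
  proof -
    have "(\<rho> x y)\<^sup>2 * (h x - h y)\<^sup>2 \<le> (\<Sum>e\<in>?E. D e / w e * J e x y \<omega>)"
      if \<omega>: "\<omega> \<in> space P" for \<omega>
    proof -
      have "(h x - h y)\<^sup>2 \<le> path_length w (\<gamma> \<omega> x y) * (\<Sum>e\<in>set (\<gamma> \<omega> x y). D e / w e)"
        unfolding D_def by (rule path_increment_le[OF _ path(1)[OF xy \<omega>] w]) unfold_locales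
      also have "(\<Sum>e\<in>set (\<gamma> \<omega> x y). D e / w e)
          = (\<Sum>e\<in>?E. indicator (set (\<gamma> \<omega> x y)) e * (D e / w e))"
        using path(2)[OF xy \<omega>] fin by (intro sum.mono_neutral_cong_left) (auto simp: indicator_def)
      finally have "(\<rho> x y)\<^sup>2 * (h x - h y)\<^sup>2 \<le> (\<rho> x y)\<^sup>2 * (path_length w (\<gamma> \<omega> x y) * \<dots>)"
        by (intro mult_left_mono) auto
      then show ?thesis by (simp add: J_def sum_distrib_left mult_ac)
    qed
    then have "(\<integral>\<omega>. (\<rho> x y)\<^sup>2 * (h x - h y)\<^sup>2 \<partial>P) \<le> (\<integral>\<omega>. (\<Sum>e\<in>?E. D e / w e * J e x y \<omega>) \<partial>P)"
      using int[OF xy] by (intro integral_mono) auto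
    also have "\<dots> = (\<Sum>e\<in>?E. D e / w e * (\<integral>\<omega>. J e x y \<omega> \<partial>P))"
      using int[OF xy] by (simp add: Bochner_Integration.integral_sum)
    finally show ?thesis by (simp add: P.prob_space)
  qed
  have "weighted_variation ?V \<rho> \<mu> h
      \<le> (\<Sum>x\<in>?V. \<Sum>y\<in>?V. (\<Sum>e\<in>?E. D e / w e * (\<integral>\<omega>. J e x y \<omega> \<partial>P)) * (pmf \<mu> x * pmf \<mu> y))"
    unfolding weighted_variation_def by (intro sum_mono mult_right_mono pointwise) auto
  also have "\<dots> = (\<Sum>x\<in>?V. \<Sum>e\<in>?E. \<Sum>y\<in>?V. D e / w e * ((\<integral>\<omega>. J e x y \<omega> \<partial>P) * pmf \<mu> x * pmf \<mu> y))"
    unfolding sum_distrib_right by (intro sum.cong[OF refl]) (subst sum.swap, simp add: mult_ac)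
  also have "\<dots> = (\<Sum>e\<in>?E. D e / w e * S e)"
    by (subst sum.swap) (simp add: S_def sum_distrib_left)
  also have "\<dots> \<le> (\<Sum>e\<in>?E. Kw G \<mu> q \<rho> P \<gamma> w * (Qflow \<mu> q e * D e))"
  proof (rule sum_mono)
    fix e assume e: "e \<in> ?E"
    have "1 / (Qflow \<mu> q e * w e) * S e \<le> Kw G \<mu> q \<rho> P \<gamma> w"
      using e fin unfolding Kw_def S_def J_def by (auto intro!: Max_ge)
    then have "S e / w e \<le> Kw G \<mu> q \<rho> P \<gamma> w * Qflow \<mu> q e"
      using Q[OF e] w_pos[OF e] by (simp add: field_simps)
    then have "D e * (S e / w e) \<le> D e * (Kw G \<mu> q \<rho> P \<gamma> w * Qflow \<mu> q e)"
      by (rule mult_left_mono) (simp add: D_def)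
    then show "D e / w e * S e \<le> Kw G \<mu> q \<rho> P \<gamma> w * (Qflow \<mu> q e * D e)"
      by (simp add: mult_ac)
  qed
  finally show ?thesis by (simp add: Dirichlet_energy_def D_def sum_distrib_left)
qed

lemma Kw_nonneg:
  assumes G: "pair_graph G" and \<gamma>: "random_paths G P \<gamma>" and w: "length_function (parcs G) w"
    and Q: "\<And>e. e \<in> parcs G \<Longrightarrow> 0 < Qflow \<mu> q e"
  shows "0 \<le> Kw G \<mu> q \<rho> P \<gamma> w"
proof (cases "parcs G = {}")
  case True
  then show ?thesis by (simp add: Kw_def)
next
  case False
  then obtain e where e: "e \<in> parcs G" by blast
  interpret pair_graph G by fact
  have "0 < w e" using w e by (auto simp: length_function_def)
  then have "0 \<le> 1 / (Qflow \<mu> q e * w e) *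
             (\<Sum>x\<in>pverts G. \<Sum>y\<in>pverts G.
                (\<integral>\<omega>. indicator (set (\<gamma> \<omega> x y)) e * (\<rho> x y)\<^sup>2 * path_length w (\<gamma> \<omega> x y) \<partial>P)
                * pmf \<mu> x * pmf \<mu> y)"
    using Q[OF e] by (intro mult_nonneg_nonneg sum_nonneg random_paths_nonneg_integral[OF \<gamma> w]) auto
  also have "\<dots> \<le> Kw G \<mu> q \<rho> P \<gamma> w"
    using e pair_finite_arcs unfolding Kw_def by (auto intro!: Max_ge)
  finally show ?thesis .
qed

lemma length_function_one: "length_function E (\<lambda>_. 1)"
  by (auto simp: length_function_def)

lemma Kconst_nonneg:
  assumes "pair_graph G" "random_paths G P \<gamma>"
    and "\<And>e. e \<in> parcs G \<Longrightarrow> 0 < Qflow \<mu> q e"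
  shows "0 \<le> Kconst G \<mu> q \<rho> P \<gamma>"
  unfolding Kconst_def using length_function_one[of "parcs G"] Kw_nonneg[OF assms(1,2) _ assms(3)]
  by (intro cINF_greatest) auto

text \<open>The two sides do not involve the length function apart from \<open>Kw\<close>, so one may pass to the infimum.
  If the energy vanishes, dividing by it is impossible, but then any single length function shows
  that the left-hand side vanishes as well.\<close>

lemma weighted_Poincare:
  fixes h :: "'v \<Rightarrow> real"
  assumes G: "pair_graph G" and \<gamma>: "random_paths G P \<gamma>"
    and Q: "\<And>e. e \<in> parcs G \<Longrightarrow> 0 < Qflow \<mu> q e"
  shows "weighted_variation (pverts G) \<rho> \<mu> h
           \<le> Kconst G \<mu> q \<rho> P \<gamma> * Dirichlet_energy (parcs G) (Qflow \<mu> q) h"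
proof -
  let ?A = "weighted_variation (pverts G) \<rho> \<mu> h"
  let ?I = "Dirichlet_energy (parcs G) (Qflow \<mu> q) h"
  note est = canonical_path_estimate[OF G \<gamma> _ Q, of _ \<rho> h]
  have I: "0 \<le> ?I" unfolding Dirichlet_energy_def using Q
    by (intro sum_nonneg mult_nonneg_nonneg) (auto intro: less_imp_le)
  show ?thesis
  proof (cases "?I = 0")
    case True
    then show ?thesis using est[OF length_function_one] by simp
  next
    case False
    with I have I: "0 < ?I" by simp
    have "?A / ?I \<le> Kconst G \<mu> q \<rho> P \<gamma>"
      unfolding Kconst_def using est length_function_one[of "parcs G"] I
      by (intro cINF_greatest) (auto simp: pos_divide_le_eq)
    then show ?thesis using I by (simp add: pos_divide_le_eq)
  qed
qed

section \<open>Exponential moments of Lipschitz functions\<close>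

text \<open>The difference quotient of \<open>exp\<close> is an average over \<open>[b, a]\<close>, which by convexity lies below the mean
  of the values at the end points (trapezoid rule). A bound by the larger end point would be simpler, but
  the symmetric form saves the factor two that gives the constant in \<open>Dirichlet_energy_exp_le\<close>.\<close>

lemma exp_diff_squared_le:
  fixes a b :: real
  shows "(exp a - exp b)\<^sup>2 \<le> (a - b)\<^sup>2 * (((exp a)\<^sup>2 + (exp b)\<^sup>2) / 2)"
proof -
  have trap: "exp t - 1 \<le> t * ((exp t + 1) / 2)" if "0 \<le> t" for t :: real
  proof -
    define F where "F = (\<lambda>t::real. t * ((exp t + 1) / 2) - exp t)"
    have "F 0 \<le> F t"
    proof (rule DERIV_nonneg_imp_nondecreasing[OF that])
      fix s :: real assume s: "0 \<le> s"
      have "(F has_real_derivative (s * exp s + 1 - exp s) / 2) (at s)"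
        unfolding F_def by (auto intro!: derivative_eq_intros simp: field_simps)
      moreover have "0 \<le> s * exp s + 1 - exp s"
      proof -
        have "1 - s \<le> exp (- s)" using exp_ge_add_one_self[of "- s"] by simp
        then have "(1 - s) * exp s \<le> exp (- s) * exp s" by (intro mult_right_mono) auto
        then show ?thesis by (simp add: exp_minus algebra_simps)
      qed
      ultimately show "\<exists>y. (F has_real_derivative y) (at s) \<and> 0 \<le> y" by fastforce
    qed
    then show ?thesis by (simp add: F_def)
  qed
  have *: "(exp a - exp b)\<^sup>2 \<le> (a - b)\<^sup>2 * (((exp a)\<^sup>2 + (exp b)\<^sup>2) / 2)" if "b \<le> a" for a b :: real
  proof -
    have "exp a - exp b = exp b * (exp (a - b) - 1)" by (simp add: algebra_simps flip: exp_add)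
    also have "\<dots> \<le> exp b * ((a - b) * ((exp (a - b) + 1) / 2))"
      using that by (intro mult_left_mono trap) auto
    also have "\<dots> = (a - b) * ((exp a + exp b) / 2)"
      by (simp add: algebra_simps flip: exp_add)
    finally have "(exp a - exp b)\<^sup>2 \<le> ((a - b) * ((exp a + exp b) / 2))\<^sup>2"
      using that by (intro power_mono) auto
    also have "\<dots> = (a - b)\<^sup>2 * ((exp a + exp b) / 2)\<^sup>2" by (rule power_mult_distrib)
    also have "\<dots> \<le> (a - b)\<^sup>2 * (((exp a)\<^sup>2 + (exp b)\<^sup>2) / 2)"
    proof (rule mult_left_mono)
      show "((exp a + exp b) / 2)\<^sup>2 \<le> ((exp a)\<^sup>2 + (exp b)\<^sup>2) / 2"
        using zero_le_power2[of "exp a - exp b"] by (simp add: power2_eq_square field_simps)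
    qed simp
    finally show ?thesis .
  qed
  show ?thesis
    using *[of b a] *[of a b] by (cases "b \<le> a") (auto simp: power2_commute add.commute)
qed

text \<open>After \<open>exp_diff_squared_le\<close>, detailed balance makes both end points of an edge contribute
  equally, and summing over the neighbours of a vertex brings in \<open>M\<close>.\<close>

lemma Dirichlet_energy_exp_le:
  fixes u :: "'v \<Rightarrow> real"
  assumes V: "finite V" "E \<subseteq> V \<times> V" "sym E"
    and db: "detailed_balance E \<mu> q"
    and Q: "\<And>e. e \<in> E \<Longrightarrow> 0 \<le> Qflow \<mu> q e"
    and \<rho>: "\<And>x y. x \<in> V \<Longrightarrow> y \<in> V \<Longrightarrow> \<rho> x y = \<rho> y x"
    and M: "\<And>x. x \<in> V \<Longrightarrow> 1 / 2 * (\<Sum>y | (x, y) \<in> E. (\<rho> x y)\<^sup>2 * q x y) \<le> M"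
    and u: "\<And>x y. x \<in> V \<Longrightarrow> y \<in> V \<Longrightarrow> \<bar>u x - u y\<bar> \<le> L * \<rho> x y"
  shows "Dirichlet_energy E (Qflow \<mu> q) (\<lambda>x. exp (u x))
           \<le> 2 * L\<^sup>2 * M * (\<Sum>x\<in>V. pmf \<mu> x * (exp (u x))\<^sup>2)"
proof -
  have fin: "finite E" using V finite_subset by blast
  \<comment> \<open>The share of the vertex \<open>x\<close> in the edge \<open>(x, y)\<close> after the trapezoid bound.\<close>
  define F where "F x y = Qflow \<mu> q (x, y) * (\<rho> x y)\<^sup>2 * (exp (u x))\<^sup>2" for x y
  have "Dirichlet_energy E (Qflow \<mu> q) (\<lambda>x. exp (u x))
      \<le> (\<Sum>e\<in>E. L\<^sup>2 / 2 * (F (fst e) (snd e) + F (snd e) (fst e)))"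
    unfolding Dirichlet_energy_def
  proof (rule sum_mono)
    fix e assume e: "e \<in> E"
    obtain x y where xy: "e = (x, y)" by (cases e)
    have V': "x \<in> V" "y \<in> V" using e V xy by auto
    have Qs: "Qflow \<mu> q (y, x) = Qflow \<mu> q (x, y)"
      using db e xy by (auto simp: detailed_balance_def Qflow_def)
    have "(exp (u x) - exp (u y))\<^sup>2 \<le> (u x - u y)\<^sup>2 * (((exp (u x))\<^sup>2 + (exp (u y))\<^sup>2) / 2)"
      by (rule exp_diff_squared_le)
    also have "\<dots> \<le> (L * \<rho> x y)\<^sup>2 * (((exp (u x))\<^sup>2 + (exp (u y))\<^sup>2) / 2)"
      using u[OF V'] by (intro mult_right_mono abs_le_square_iff[THEN iffD1]) auto
    finally have "Qflow \<mu> q e * (exp (u x) - exp (u y))\<^sup>2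
        \<le> Qflow \<mu> q e * ((L * \<rho> x y)\<^sup>2 * (((exp (u x))\<^sup>2 + (exp (u y))\<^sup>2) / 2))"
      using Q[OF e] by (rule mult_left_mono)
    then show "Qflow \<mu> q e * (exp (u (fst e)) - exp (u (snd e)))\<^sup>2
        \<le> L\<^sup>2 / 2 * (F (fst e) (snd e) + F (snd e) (fst e))"
      using Qs \<rho>[OF V'] xy by (simp add: F_def power_mult_distrib algebra_simps)
  qed
  also have "\<dots> = L\<^sup>2 * (\<Sum>e\<in>E. F (fst e) (snd e))"
  proof -
    have "(\<Sum>e\<in>E. F (snd e) (fst e)) = (\<Sum>e\<in>E. F (fst e) (snd e))"
      using V(3) by (intro sum.reindex_bij_witness[of _ prod.swap prod.swap]) (auto dest: symD)
    then show ?thesis by (simp only: sum_distrib_left[symmetric] sum.distrib) simp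
  qed
  also have "(\<Sum>e\<in>E. F (fst e) (snd e)) = (\<Sum>x\<in>V. \<Sum>y | (x, y) \<in> E. F x y)"
  proof -
    have "E = (SIGMA x:V. {y. (x, y) \<in> E})" using V(2) by auto
    moreover have "finite {y. (x, y) \<in> E}" for x
      using V by (auto intro: finite_subset[of _ V])
    ultimately show ?thesis using V(1) sum.Sigma[of V "\<lambda>x. {y. (x, y) \<in> E}" F]
      by (simp add: case_prod_beta')
  qed
  also have "L\<^sup>2 * \<dots> \<le> L\<^sup>2 * (\<Sum>x\<in>V. 2 * M * (pmf \<mu> x * (exp (u x))\<^sup>2))"
  proof (intro mult_left_mono sum_mono)
    fix x assume x: "x \<in> V"
    have "(\<Sum>y | (x, y) \<in> E. F x y)
        = (\<Sum>y | (x, y) \<in> E. (\<rho> x y)\<^sup>2 * q x y) * (pmf \<mu> x * (exp (u x))\<^sup>2)"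
      unfolding F_def Qflow_def sum_distrib_right by (simp add: mult_ac)
    also have "\<dots> \<le> (2 * M) * (pmf \<mu> x * (exp (u x))\<^sup>2)"
      using M[OF x] by (intro mult_right_mono) auto
    finally show "(\<Sum>y | (x, y) \<in> E. F x y) \<le> 2 * M * (pmf \<mu> x * (exp (u x))\<^sup>2)" .
  qed simp
  finally show ?thesis by (simp add: sum_distrib_left mult_ac)
qed

text \<open>With \<open>T\<close> the deviation, \<open>2 T\<close> is the \<open>\<mu> \<otimes> \<mu>\<close>-integral of
  \<open>(g x - g y) (s x - s y)\<close> times \<open>s x + s y\<close>. By the Cauchy-Schwarz inequality, \<open>4 T\<^sup>2\<close> is at most the product of
  the integrals of the squares, and the second of these is at most \<open>4 \<mu>(s\<^sup>2) = 4\<close>.\<close>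

lemma tilted_mean_deviation:
  fixes g s :: "'v \<Rightarrow> real"
  assumes V: "finite V" and \<mu>: "set_pmf \<mu> \<subseteq> V"
    and s: "(\<Sum>x\<in>V. pmf \<mu> x * (s x)\<^sup>2) = 1"
    and g: "\<And>x y. x \<in> V \<Longrightarrow> y \<in> V \<Longrightarrow> \<bar>g x - g y\<bar> \<le> L * \<rho> x y"
  shows "((\<Sum>x\<in>V. pmf \<mu> x * (s x)\<^sup>2 * g x) - (\<Sum>x\<in>V. pmf \<mu> x * g x))\<^sup>2
           \<le> L\<^sup>2 * weighted_variation V \<rho> \<mu> s"
proof -
  let ?m = "\<lambda>p. pmf \<mu> (fst p) * pmf \<mu> (snd p)"
  let ?d = "\<lambda>f p. f (fst p) - f (snd p) :: real"
  have \<mu>1: "(\<Sum>x\<in>V. pmf \<mu> x) = 1" by (rule sum_pmf_eq_1[OF V \<mu>])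
  have prod: "(\<Sum>p\<in>V \<times> V. ?m p * (f (fst p) * f' (snd p)))
      = (\<Sum>x\<in>V. pmf \<mu> x * f x) * (\<Sum>y\<in>V. pmf \<mu> y * f' y)" for f f' :: "'v \<Rightarrow> real"
    unfolding sum_product sum.cartesian_product case_prod_beta' by (simp add: mult_ac)
  have fst_marginal: "(\<Sum>p\<in>V \<times> V. ?m p * f (fst p)) = (\<Sum>x\<in>V. pmf \<mu> x * f x)"
    and snd_marginal: "(\<Sum>p\<in>V \<times> V. ?m p * f (snd p)) = (\<Sum>x\<in>V. pmf \<mu> x * f x)" for f :: "'v \<Rightarrow> real"
    using prod[of f "\<lambda>_. 1"] prod[of "\<lambda>_. 1" f] \<mu>1 by simp_all
  define T where "T = (\<Sum>x\<in>V. pmf \<mu> x * (s x)\<^sup>2 * g x) - (\<Sum>x\<in>V. pmf \<mu> x * g x)"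
  have 2: "2 * T = (\<Sum>p\<in>V \<times> V. (?d g p * ?d s p * sqrt (?m p)) * ((s (fst p) + s (snd p)) * sqrt (?m p)))"
  proof -
    have "(\<Sum>p\<in>V \<times> V. (?d g p * ?d s p * sqrt (?m p)) * ((s (fst p) + s (snd p)) * sqrt (?m p)))
       = (\<Sum>p\<in>V \<times> V. ?m p * ((s (fst p))\<^sup>2 * g (fst p))) + (\<Sum>p\<in>V \<times> V. ?m p * ((s (snd p))\<^sup>2 * g (snd p)))
         - (\<Sum>p\<in>V \<times> V. ?m p * ((s (fst p))\<^sup>2 * g (snd p))) - (\<Sum>p\<in>V \<times> V. ?m p * (g (fst p) * (s (snd p))\<^sup>2))"
      unfolding sum.distrib[symmetric] sum_subtractf[symmetric]
    proof (rule sum.cong[OF refl])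
      fix p
      have "sqrt (?m p) * sqrt (?m p) = ?m p" by simp
      then show "(?d g p * ?d s p * sqrt (?m p)) * ((s (fst p) + s (snd p)) * sqrt (?m p)) =
          ?m p * ((s (fst p))\<^sup>2 * g (fst p)) + ?m p * ((s (snd p))\<^sup>2 * g (snd p))
          - ?m p * ((s (fst p))\<^sup>2 * g (snd p)) - ?m p * (g (fst p) * (s (snd p))\<^sup>2)"
        by algebra
    qed
    also have "\<dots> = 2 * T"
      unfolding fst_marginal[of "\<lambda>x. (s x)\<^sup>2 * g x"] snd_marginal[of "\<lambda>x. (s x)\<^sup>2 * g x"]
        prod[of "\<lambda>x. (s x)\<^sup>2" g] prod[of g "\<lambda>x. (s x)\<^sup>2"] s
      by (simp add: T_def mult.assoc)
    finally show ?thesis by simp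
  qed
  have "(2 * T)\<^sup>2 \<le> (\<Sum>p\<in>V \<times> V. (?d g p * ?d s p * sqrt (?m p))\<^sup>2)
      * (\<Sum>p\<in>V \<times> V. ((s (fst p) + s (snd p)) * sqrt (?m p))\<^sup>2)"
    unfolding 2 by (rule Cauchy_Schwarz_ineq_sum)
  also have "\<dots> \<le> (L\<^sup>2 * weighted_variation V \<rho> \<mu> s) * 4"
  proof (rule mult_mono)
    have "(\<Sum>p\<in>V \<times> V. (?d g p * ?d s p * sqrt (?m p))\<^sup>2)
        \<le> (\<Sum>p\<in>V \<times> V. (L * \<rho> (fst p) (snd p))\<^sup>2 * (?d s p)\<^sup>2 * ?m p)"
    proof (rule sum_mono)
      fix p assume "p \<in> V \<times> V"
      then have "(?d g p)\<^sup>2 \<le> (L * \<rho> (fst p) (snd p))\<^sup>2"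
        using g[of "fst p" "snd p"] by (intro abs_le_square_iff[THEN iffD1]) auto
      then show "(?d g p * ?d s p * sqrt (?m p))\<^sup>2 \<le> (L * \<rho> (fst p) (snd p))\<^sup>2 * (?d s p)\<^sup>2 * ?m p"
        by (simp add: power_mult_distrib mult_right_mono)
    qed
    then show "(\<Sum>p\<in>V \<times> V. (?d g p * ?d s p * sqrt (?m p))\<^sup>2) \<le> L\<^sup>2 * weighted_variation V \<rho> \<mu> s"
      by (simp add: weighted_variation_def sum_distrib_left sum.cartesian_product case_prod_beta'
          power_mult_distrib mult_ac)
    have "(\<Sum>p\<in>V \<times> V. ((s (fst p) + s (snd p)) * sqrt (?m p))\<^sup>2)
        \<le> (\<Sum>p\<in>V \<times> V. ?m p * (2 * (s (fst p))\<^sup>2) + ?m p * (2 * (s (snd p))\<^sup>2))"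
    proof (rule sum_mono)
      fix p
      have "(s (fst p) + s (snd p))\<^sup>2 \<le> 2 * (s (fst p))\<^sup>2 + 2 * (s (snd p))\<^sup>2"
        using zero_le_power2[of "s (fst p) - s (snd p)"] by (simp add: power2_eq_square algebra_simps)
      then have "?m p * (s (fst p) + s (snd p))\<^sup>2 \<le> ?m p * (2 * (s (fst p))\<^sup>2 + 2 * (s (snd p))\<^sup>2)"
        by (intro mult_left_mono) auto
      then show "((s (fst p) + s (snd p)) * sqrt (?m p))\<^sup>2 \<le> ?m p * (2 * (s (fst p))\<^sup>2) + ?m p * (2 * (s (snd p))\<^sup>2)"
        unfolding power_mult_distrib by (simp add: algebra_simps)
    qed
    also have "\<dots> = 4"
      using s fst_marginal[of "\<lambda>x. (s x)\<^sup>2"] snd_marginal[of "\<lambda>x. (s x)\<^sup>2"]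
      by (simp add: sum.distrib mult.left_commute[of _ 2] flip: sum_distrib_left)
    finally show "(\<Sum>p\<in>V \<times> V. ((s (fst p) + s (snd p)) * sqrt (?m p))\<^sup>2) \<le> 4" .
  qed (auto simp: weighted_variation_def intro!: sum_nonneg mult_nonneg_nonneg)
  finally have "T\<^sup>2 \<le> L\<^sup>2 * weighted_variation V \<rho> \<mu> s" by (simp add: power_mult_distrib)
  then show ?thesis unfolding T_def .
qed

text \<open>The hypothesis is the differential inequality \<open>Z' \<le> (m + t d) Z\<close>, so \<open>Z\<close> divided by
  \<open>exp (t m + t\<^sup>2 d / 2)\<close> decreases from its value 1 at \<open>t = 0\<close>.\<close>

lemma exp_moment_le_of_tilted_mean:
  fixes g :: "'v \<Rightarrow> real"
  assumes V: "finite V" and \<mu>: "set_pmf \<mu> \<subseteq> V" and l: "0 \<le> l"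
    and tilt: "\<And>t. 0 \<le> t \<Longrightarrow> (\<Sum>x\<in>V. pmf \<mu> x * exp (t * g x) * g x)
         \<le> (m + t * d) * (\<Sum>x\<in>V. pmf \<mu> x * exp (t * g x))"
  shows "(\<Sum>x\<in>V. pmf \<mu> x * exp (l * g x)) \<le> exp (l * m + l\<^sup>2 * d / 2)"
proof -
  define Z where "Z = (\<lambda>t. \<Sum>x\<in>V. pmf \<mu> x * exp (t * g x))"
  define F where "F = (\<lambda>t. Z t * exp (- (t * m + t\<^sup>2 * d / 2)))"
  have "F l \<le> F 0"
  proof (rule DERIV_nonpos_imp_nonincreasing[OF l])
    fix t :: real assume t: "0 \<le> t"
    have "(Z has_real_derivative (\<Sum>x\<in>V. pmf \<mu> x * exp (t * g x) * g x)) (at t)"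
      unfolding Z_def by (auto intro!: derivative_eq_intros simp: mult_ac)
    then have "(F has_real_derivative
        ((\<Sum>x\<in>V. pmf \<mu> x * exp (t * g x) * g x) - (m + t * d) * Z t) * exp (- (t * m + t\<^sup>2 * d / 2))) (at t)"
      unfolding F_def by (auto intro!: derivative_eq_intros simp: field_simps)
    moreover have "((\<Sum>x\<in>V. pmf \<mu> x * exp (t * g x) * g x) - (m + t * d) * Z t)
        * exp (- (t * m + t\<^sup>2 * d / 2)) \<le> 0"
      using tilt[OF t] by (intro mult_nonpos_nonneg) (auto simp: Z_def)
    ultimately show "\<exists>y. (F has_real_derivative y) (at t) \<and> y \<le> 0" by blast
  qed
  also have "F 0 = 1" using sum_pmf_eq_1[OF V \<mu>] by (simp add: F_def Z_def)
  finally show ?thesis by (simp add: F_def Z_def exp_minus field_simps)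
qed

text \<open>The tilted measure at parameter \<open>t\<close> has density \<open>(exp (u x))\<^sup>2\<close> with respect to \<open>\<mu>\<close>, where \<open>u\<close> is Lipschitz
  with constant \<open>t L / 2\<close>. Chaining the deviation bound, the weighted Poincare inequality and the energy
  bound for \<open>exp u\<close> moves its mean by at most \<open>t d\<close> with \<open>d = L\<^sup>2 sqrt (2 M K) / 2\<close>, which is the
  differential inequality required by \<open>exp_moment_le_of_tilted_mean\<close>.\<close>

lemma exp_moment_le:
  fixes g :: "'v \<Rightarrow> real"
  assumes G: "pair_graph G" and \<gamma>: "random_paths G P \<gamma>"
    and Q: "\<And>e. e \<in> parcs G \<Longrightarrow> 0 < Qflow \<mu> q e"
    and \<mu>: "set_pmf \<mu> = pverts G"
    and db: "detailed_balance (parcs G) \<mu> q"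
    and \<rho>: "\<And>x y. x \<in> pverts G \<Longrightarrow> y \<in> pverts G \<Longrightarrow> \<rho> x y = \<rho> y x"
    and M: "0 < M" "\<And>x. x \<in> pverts G \<Longrightarrow> 1 / 2 * (\<Sum>y | (x, y) \<in> parcs G. (\<rho> x y)\<^sup>2 * q x y) \<le> M"
    and g: "\<And>x y. x \<in> pverts G \<Longrightarrow> y \<in> pverts G \<Longrightarrow> \<bar>g x - g y\<bar> \<le> L * \<rho> x y"
  shows "(\<Sum>x\<in>pverts G. pmf \<mu> x * exp (l * g x))
      \<le> exp (l * (\<Sum>x\<in>pverts G. pmf \<mu> x * g x) + l\<^sup>2 * sqrt (2 * M * Kconst G \<mu> q \<rho> P \<gamma>) / 4 * L\<^sup>2)"
proof -
  interpret pair_graph G by fact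
  let ?V = "pverts G" and ?K = "Kconst G \<mu> q \<rho> P \<gamma>"
  have V: "finite ?V" by (rule pair_finite_verts)
  have E: "parcs G \<subseteq> ?V \<times> ?V" "sym (parcs G)"
    using arc_fst_in_verts arc_snd_in_verts pair_sym_arcs by (force simp: symmetric_def)+
  have K: "0 \<le> ?K" by (rule Kconst_nonneg[OF G \<gamma> Q])
  have nonneg: "(\<Sum>x\<in>?V. pmf \<mu> x * exp (l * g x))
      \<le> exp (l * (\<Sum>x\<in>?V. pmf \<mu> x * g x) + l\<^sup>2 * (L\<^sup>2 * sqrt (2 * M * ?K) / 2) / 2)"
    if l: "0 \<le> l" and g: "\<And>x y. x \<in> ?V \<Longrightarrow> y \<in> ?V \<Longrightarrow> \<bar>g x - g y\<bar> \<le> L * \<rho> x y" for l g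
  proof (rule exp_moment_le_of_tilted_mean[OF V _ l])
    fix t :: real assume t: "0 \<le> t"
    define m where "m = (\<Sum>x\<in>?V. pmf \<mu> x * g x)"
    define Z where "Z = (\<Sum>x\<in>?V. pmf \<mu> x * exp (t * g x))"
    have "?V \<noteq> {}" using \<mu> set_pmf_not_empty by metis
    then have Z: "0 < Z" unfolding Z_def using V \<mu> by (intro sum_pos mult_pos_pos) (auto intro: pmf_positive)
    \<comment> \<open>\<open>exp u\<close> is the square root of the tilted density, and \<open>u\<close> has Lipschitz constant \<open>t L / 2\<close>.\<close>
    define u where "u x = t * g x / 2 - ln Z / 2" for x
    have sq: "(exp (u x))\<^sup>2 = exp (t * g x) / Z" for x
      using Z by (simp add: u_def exp_diff power2_eq_square flip: exp_add)
    have mass: "(\<Sum>x\<in>?V. pmf \<mu> x * (exp (u x))\<^sup>2) = 1"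
      using Z by (simp add: sq Z_def flip: sum_divide_distrib)
    have "\<bar>u x - u y\<bar> \<le> (t * L / 2) * \<rho> x y" if "x \<in> ?V" "y \<in> ?V" for x y
    proof -
      have "\<bar>u x - u y\<bar> = t / 2 * \<bar>g x - g y\<bar>"
        using t by (simp add: u_def abs_mult flip: right_diff_distrib diff_divide_distrib)
      also have "\<dots> \<le> t / 2 * (L * \<rho> x y)" using t g[OF that] by (intro mult_left_mono) auto
      finally show ?thesis by simp
    qed
    \<comment> \<open>The trailing factor 1 is the total mass of the tilted measure.\<close>
    then have energy: "Dirichlet_energy (parcs G) (Qflow \<mu> q) (\<lambda>x. exp (u x)) \<le> 2 * (t * L / 2)\<^sup>2 * M * 1"
      unfolding mass[symmetric] using Q
      by (intro Dirichlet_energy_exp_le[OF V E db _ \<rho> M(2)]) (auto intro: less_imp_le)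
    have "((\<Sum>x\<in>?V. pmf \<mu> x * (exp (u x))\<^sup>2 * g x) - m)\<^sup>2
        \<le> L\<^sup>2 * weighted_variation ?V \<rho> \<mu> (\<lambda>x. exp (u x))"
      unfolding m_def using \<mu> by (intro tilted_mean_deviation[OF V _ mass g]) auto
    also have "\<dots> \<le> L\<^sup>2 * (?K * (2 * (t * L / 2)\<^sup>2 * M * 1))"
      using order.trans[OF weighted_Poincare[OF G \<gamma> Q] mult_left_mono[OF energy K]]
      by (rule mult_left_mono) auto
    also have "\<dots> = (t * (L\<^sup>2 * sqrt (2 * M * ?K) / 2))\<^sup>2"
      using M(1) K by (simp add: power_mult_distrib power_divide power2_eq_square[of "L\<^sup>2"] power2_eq_square[of L])
    finally have "(\<Sum>x\<in>?V. pmf \<mu> x * (exp (u x))\<^sup>2 * g x) - m \<le> t * (L\<^sup>2 * sqrt (2 * M * ?K) / 2)"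
      by (rule power2_le_imp_le) (use t M(1) K in simp)
    moreover have "(\<Sum>x\<in>?V. pmf \<mu> x * (exp (u x))\<^sup>2 * g x) = (\<Sum>x\<in>?V. pmf \<mu> x * exp (t * g x) * g x) / Z"
      by (simp add: sq sum_divide_distrib)
    ultimately have "(\<Sum>x\<in>?V. pmf \<mu> x * exp (t * g x) * g x) / Z \<le> m + t * (L\<^sup>2 * sqrt (2 * M * ?K) / 2)"
      by linarith
    then show "(\<Sum>x\<in>?V. pmf \<mu> x * exp (t * g x) * g x)
        \<le> ((\<Sum>x\<in>?V. pmf \<mu> x * g x) + t * (L\<^sup>2 * sqrt (2 * M * ?K) / 2)) * (\<Sum>x\<in>?V. pmf \<mu> x * exp (t * g x))"
      using Z by (simp add: pos_divide_le_eq flip: m_def Z_def)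
  qed (use \<mu> in auto)
  show ?thesis
  proof (cases "0 \<le> l")
    case True
    then show ?thesis using nonneg[OF True g] by (simp add: mult_ac)
  next
    case False
    then have "0 \<le> - l" by simp
    \<comment> \<open>Negative \<open>l\<close> reduces to positive \<open>l\<close> by replacing \<open>g\<close> with \<open>- g\<close>.\<close>
    from nonneg[OF this, of "\<lambda>x. - g x"] show ?thesis
      using g by (simp add: sum_negf mult_ac abs_minus_commute)
  qed
qed

section \<open>Entropy and the transport-entropy inequality\<close>

text \<open>Jensen's inequality in the form \<open>ln r \<le> r - 1\<close>, where \<open>r\<close> is the density with respect to \<open>\<nu>\<close> of the
  Gibbs measure with weights \<open>\<mu> x exp (h x)\<close>, normalised.\<close>

lemma Gibbs_variational_inequality:
  fixes h :: "'v \<Rightarrow> real"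
  assumes V: "finite V" and \<nu>: "set_pmf \<nu> \<subseteq> V" and \<mu>: "set_pmf \<mu> = V"
  shows "(\<Sum>x\<in>V. pmf \<nu> x * h x)
           \<le> (\<Sum>x\<in>V. pmf \<nu> x * ln (pmf \<nu> x / pmf \<mu> x)) + ln (\<Sum>x\<in>V. pmf \<mu> x * exp (h x))"
proof -
  define Z where "Z = (\<Sum>x\<in>V. pmf \<mu> x * exp (h x))"
  have pos: "0 < pmf \<mu> x" if "x \<in> V" for x using that \<mu> by (simp add: pmf_positive)
  have "V \<noteq> {}" using \<mu> set_pmf_not_empty by metis
  then have Z: "0 < Z" unfolding Z_def using V pos by (intro sum_pos) auto
  have "pmf \<nu> x * h x - pmf \<nu> x * ln (pmf \<nu> x / pmf \<mu> x) - pmf \<nu> x * ln Z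
      \<le> pmf \<mu> x * exp (h x) / Z - pmf \<nu> x" if x: "x \<in> V" for x
  proof (cases "pmf \<nu> x = 0")
    case True
    then show ?thesis using Z by simp
  next
    case False
    then have n: "0 < pmf \<nu> x" by (simp add: less_le)
    define r where "r = pmf \<mu> x * exp (h x) / (Z * pmf \<nu> x)"
    have "ln r \<le> r - 1" using n Z pos[OF x] by (intro ln_le_minus_one) (simp add: r_def)
    moreover have "ln r = h x - ln (pmf \<nu> x / pmf \<mu> x) - ln Z"
      using n Z pos[OF x] by (simp add: r_def ln_div ln_mult)
    ultimately have "pmf \<nu> x * (h x - ln (pmf \<nu> x / pmf \<mu> x) - ln Z) \<le> pmf \<nu> x * (r - 1)"
      by (intro mult_left_mono) auto
    also have "\<dots> = pmf \<mu> x * exp (h x) / Z - pmf \<nu> x"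
      using n Z by (simp add: r_def field_simps)
    finally show ?thesis by (simp add: algebra_simps)
  qed
  then have "(\<Sum>x\<in>V. pmf \<nu> x * h x - pmf \<nu> x * ln (pmf \<nu> x / pmf \<mu> x) - pmf \<nu> x * ln Z)
      \<le> (\<Sum>x\<in>V. pmf \<mu> x * exp (h x) / Z - pmf \<nu> x)"
    by (rule sum_mono)
  moreover have "(\<Sum>x\<in>V. pmf \<mu> x * exp (h x) / Z - pmf \<nu> x) = 0"
    using Z sum_pmf_eq_1[OF V \<nu>] by (simp add: sum_subtractf Z_def flip: sum_divide_distrib)
  moreover have "(\<Sum>x\<in>V. pmf \<nu> x * ln Z) = ln Z"
    using sum_pmf_eq_1[OF V \<nu>] by (simp flip: sum_distrib_right)
  ultimately show ?thesis by (simp add: sum_subtractf Z_def)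
qed

lemma absolutely_continuous_pmf:
  assumes "set_pmf \<nu> \<subseteq> set_pmf \<mu>"
  shows "absolutely_continuous (measure_pmf \<mu>) (measure_pmf \<nu>)"
  using assms by (auto simp: absolutely_continuous_def null_sets_def measure_pmf.emeasure_eq_measure
      measure_pmf_zero_iff)

text \<open>The infimum that defines the Lipschitz norm is attained: divide by \<open>\<rho> x y\<close>.\<close>

lemma Lip_norm_bound:
  assumes \<rho>: "Metric_space V \<rho>"
    and g: "Lipschitz_continuous_map (metric (V, \<rho>)) euclidean_metric (g :: 'v \<Rightarrow> real)"
    and xy: "x \<in> V" "y \<in> V"
  shows "\<bar>g x - g y\<bar> \<le> Lip_norm V \<rho> g * \<rho> x y"
proof (cases "x = y")
  case True
  then show ?thesis using Metric_space.zero[OF \<rho> xy] by simp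
next
  case False
  interpret Metric_space V \<rho> by fact
  have pos: "0 < \<rho> x y" using False xy by (simp add: mdist_pos_less)
  obtain B where B: "\<And>x y. x \<in> V \<Longrightarrow> y \<in> V \<Longrightarrow> \<bar>g x - g y\<bar> \<le> B * \<rho> x y"
    using g by (auto simp: Lipschitz_continuous_map_def dist_real_def)
  have "\<bar>g x - g y\<bar> \<le> max 0 B * \<rho> x y" if "x \<in> V" "y \<in> V" for x y
    using B[OF that] mult_right_mono[of B "max 0 B" "\<rho> x y"] by simp
  then have "{L. 0 \<le> L \<and> (\<forall>x\<in>V. \<forall>y\<in>V. \<bar>g x - g y\<bar> \<le> L * \<rho> x y)} \<noteq> {}"
    using max.cobounded1[of 0 B] by blast
  then have "\<bar>g x - g y\<bar> / \<rho> x y \<le> Lip_norm V \<rho> g"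
    unfolding Lip_norm_def using pos xy by (elim cInf_greatest) (auto simp: pos_divide_le_eq)
  then show ?thesis using pos by (simp add: pos_divide_le_eq)
qed

text \<open>For \<open>c > 0\<close> the best choice is \<open>l = 2 W / c\<close>; for \<open>c = 0\<close> a large \<open>l\<close> forces \<open>W = 0\<close>.\<close>

lemma square_le_of_linear_le_quadratic:
  fixes W H c :: real
  assumes "0 \<le> c" "0 \<le> W" and *: "\<And>l. l * W \<le> H + l\<^sup>2 * c / 4"
  shows "W\<^sup>2 \<le> c * H"
proof (cases "c = 0")
  case True
  have "W = 0"
  proof (rule ccontr)
    assume "W \<noteq> 0"
    then show False using *[of "(H + 1) / W"] True by simp
  qed
  then show ?thesis using True by simp
next
  case False
  with assms have c: "0 < c" by simp
  have "2 * W / c * W \<le> H + (2 * W / c)\<^sup>2 * c / 4" by (rule *)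
  then show ?thesis using c by (simp add: power2_eq_square field_simps)
qed

theorem corollary3p3:
  fixes G :: "'v pair_pre_digraph"
    and q \<rho> :: "'v \<Rightarrow> 'v \<Rightarrow> real"
    and \<mu> :: "'v pmf"
    and P :: "'w measure"
    and \<gamma> :: "'w \<Rightarrow> 'v \<Rightarrow> 'v \<Rightarrow> ('v \<times> 'v) list"
    and M :: real
  assumes "pair_graph G"
    and "Digraph_Component.connected (with_proj G)"
    and "\<And>x y. x \<in> pverts G \<Longrightarrow> y \<in> pverts G \<Longrightarrow> 0 \<le> q x y"
    and "\<And>x y. x \<in> pverts G \<Longrightarrow> y \<in> pverts G \<Longrightarrow> 0 < q x y \<longleftrightarrow> (x, y) \<in> parcs G"
    and "set_pmf \<mu> \<subseteq> pverts G"
    and "detailed_balance (parcs G) \<mu> q"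
    and "random_paths G P \<gamma>"
    and "Metric_space (pverts G) \<rho>"
    and "0 < M"
    and "(SUP x\<in>pverts G. 1 / 2 * (\<Sum>y | (x, y) \<in> parcs G. (\<rho> x y)\<^sup>2 * q x y)) \<le> M"
  shows "(\<forall>\<nu>. set_pmf \<nu> \<subseteq> pverts G \<longrightarrow>
            ereal ((W1 (pverts G) \<rho> \<nu> \<mu>)\<^sup>2)
              \<le> ereal (sqrt (2 * Kconst G \<mu> q \<rho> P \<gamma> * M)) * rel_entropy (pverts G) \<nu> \<mu>)
       \<and> (\<forall>g. Lipschitz_continuous_map (metric (pverts G, \<rho>)) euclidean_metric g \<longrightarrow>
            (\<forall>l::real.
              measure_pmf.expectation \<mu> (\<lambda>x. exp (l * (g x - measure_pmf.expectation \<mu> g)))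
                \<le> exp (l\<^sup>2 * sqrt (2 * M * Kconst G \<mu> q \<rho> P \<gamma>) / 4
                        * (Lip_norm (pverts G) \<rho> g)\<^sup>2)))"
proof -
  interpret pair_graph G by fact
  interpret Metric_space "pverts G" \<rho> by fact
  let ?V = "pverts G" and ?K = "Kconst G \<mu> q \<rho> P \<gamma>"
  have V: "finite ?V" by (rule pair_finite_verts)
  have arc: "x \<in> ?V \<and> y \<in> ?V \<and> (y, x) \<in> parcs G" if "(x, y) \<in> parcs G" for x y
    using that in_arcsD1 in_arcsD2 pair_sym_arcs by (auto simp: symmetric_def dest: symD)
  have q: "0 < q x y \<and> 0 < q y x" if "(x, y) \<in> parcs G" for x y
    using arc[OF that] that assms(4) by auto
  have \<mu>: "set_pmf \<mu> = ?V" by (rule set_pmf_eq_pverts[OF assms(7,5,6) q])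
  have Q: "0 < Qflow \<mu> q e" if "e \<in> parcs G" for e
    using that arc[of "fst e" "snd e"] q[of "fst e" "snd e"] \<mu> by (simp add: Qflow_def pmf_positive)
  have M: "1 / 2 * (\<Sum>y | (x, y) \<in> parcs G. (\<rho> x y)\<^sup>2 * q x y) \<le> M" if "x \<in> ?V" for x
    using that V by (intro order.trans[OF cSUP_upper assms(10)]) auto
  have moment: "(\<Sum>x\<in>?V. pmf \<mu> x * exp (l * g x))
      \<le> exp (l * (\<Sum>x\<in>?V. pmf \<mu> x * g x) + l\<^sup>2 * sqrt (2 * M * ?K) / 4 * L\<^sup>2)"
    if "\<And>x y. x \<in> ?V \<Longrightarrow> y \<in> ?V \<Longrightarrow> \<bar>g x - g y\<bar> \<le> L * \<rho> x y" for g L l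
    by (rule exp_moment_le[OF assms(1,7) Q \<mu> assms(6) commute assms(9) M that])
  have K: "0 \<le> ?K" by (rule Kconst_nonneg[OF assms(1,7) Q])
  define c where "c = sqrt (2 * M * ?K)"
  have c: "0 \<le> c" using K assms(9) by (simp add: c_def)
  have ex: "measure_pmf.expectation \<mu> f = (\<Sum>x\<in>?V. pmf \<mu> x * f x)" for f :: "'v \<Rightarrow> real"
    using integral_measure_pmf_real[OF V, of \<mu> f] \<mu> by (simp add: mult.commute)
  show ?thesis
  proof (intro conjI allI impI)
    fix \<nu> assume \<nu>: "set_pmf \<nu> \<subseteq> ?V"
    define H where "H = (\<Sum>x\<in>?V. pmf \<nu> x * ln (pmf \<nu> x / pmf \<mu> x))"
    define W where "W = W1 ?V \<rho> \<nu> \<mu>"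
    obtain g where g: "\<And>x y. x \<in> ?V \<Longrightarrow> y \<in> ?V \<Longrightarrow> g x - g y \<le> \<rho> x y"
      and dual: "W \<le> (\<Sum>x\<in>?V. pmf \<nu> x * g x) - (\<Sum>x\<in>?V. pmf \<mu> x * g x)"
      unfolding W_def using Kantorovich_dual_potential[OF V \<nu> \<mu> assms(8)] by blast
    have W: "0 \<le> W" unfolding W_def by (intro W1_nonneg) auto
    have g': "\<bar>g x - g y\<bar> \<le> 1 * \<rho> x y" if "x \<in> ?V" "y \<in> ?V" for x y
      using g[OF that] g[OF that(2,1)] commute[of x y] by (simp add: abs_le_iff)
    have "l * W \<le> H + l\<^sup>2 * c / 4" for l
    proof -
      \<comment> \<open>Multiplying the duality bound by \<open>l\<close> preserves it only for \<open>l \<ge> 0\<close>. For negative \<open>l\<close> the left-hand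
          side is nonpositive, and the case \<open>l = 0\<close> shows that the entropy \<open>H\<close> is nonnegative.\<close>
      have H: "l * W \<le> H + l\<^sup>2 * c / 4" if l: "0 \<le> l" for l
      proof -
        let ?Z = "\<Sum>x\<in>?V. pmf \<mu> x * exp (l * g x)"
        have "?V \<noteq> {}" using \<mu> set_pmf_not_empty by metis
        then have Z: "0 < ?Z" using V \<mu> by (intro sum_pos mult_pos_pos) (auto intro: pmf_positive)
        have "(\<Sum>x\<in>?V. pmf \<nu> x * (l * g x)) \<le> H + ln ?Z"
          unfolding H_def by (rule Gibbs_variational_inequality[OF V \<nu> \<mu>])
        moreover have "ln ?Z \<le> l * (\<Sum>x\<in>?V. pmf \<mu> x * g x) + l\<^sup>2 * c / 4"
          using ln_mono[OF moment[of g 1 l, OF g']] Z by (simp add: c_def)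
        moreover have "l * W \<le> l * ((\<Sum>x\<in>?V. pmf \<nu> x * g x) - (\<Sum>x\<in>?V. pmf \<mu> x * g x))"
          using l dual by (rule mult_left_mono[rotated])
        ultimately show ?thesis by (simp add: algebra_simps sum_distrib_left)
      qed
      show ?thesis
      proof (cases "0 \<le> l")
        case False
        then have "l * W \<le> 0" using W by (simp add: mult_nonpos_nonneg)
        moreover have "0 \<le> H" using H[of 0] by simp
        ultimately show ?thesis using c by (smt (verit) divide_nonneg_nonneg mult_nonneg_nonneg zero_le_power2)
      qed (rule H)
    qed
    then have "W\<^sup>2 \<le> c * H" by (rule square_le_of_linear_le_quadratic[OF c W])
    then show "ereal ((W1 ?V \<rho> \<nu> \<mu>)\<^sup>2) \<le> ereal (sqrt (2 * ?K * M)) * rel_entropy ?V \<nu> \<mu>"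
      using absolutely_continuous_pmf[of \<nu> \<mu>] \<nu> \<mu>
      by (simp add: rel_entropy_def W_def H_def c_def mult_ac)
  next
    fix g :: "'v \<Rightarrow> real" and l :: real
    assume "Lipschitz_continuous_map (metric (?V, \<rho>)) euclidean_metric g"
    note lip = Lip_norm_bound[OF assms(8) this]
    define m where "m = (\<Sum>x\<in>?V. pmf \<mu> x * g x)"
    have "(\<Sum>x\<in>?V. pmf \<mu> x * exp (l * (g x - m))) = (\<Sum>x\<in>?V. pmf \<mu> x * exp (l * g x)) * exp (- (l * m))"
      unfolding sum_distrib_right by (simp add: right_diff_distrib exp_diff exp_minus divide_inverse mult.assoc)
    also have "\<dots> \<le> exp (l * m + l\<^sup>2 * c / 4 * (Lip_norm ?V \<rho> g)\<^sup>2) * exp (- (l * m))"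
      unfolding m_def c_def by (intro mult_right_mono moment lip) auto
    also have "\<dots> = exp (l\<^sup>2 * c / 4 * (Lip_norm ?V \<rho> g)\<^sup>2)" by (simp flip: exp_add)
    finally show "measure_pmf.expectation \<mu> (\<lambda>x. exp (l * (g x - measure_pmf.expectation \<mu> g)))
        \<le> exp (l\<^sup>2 * sqrt (2 * M * ?K) / 4 * (Lip_norm ?V \<rho> g)\<^sup>2)"
      by (simp add: ex m_def c_def)
  qed
qed

end
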